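(* Let $q\ge 0$ be an integer, let $G$ be a group, and let $k$ be an odd integer. If $(g\otimes g)^k=1$ in $G\otimes^q G$ for all $g\in G$, then $G\otimes^q G\cong \nabla^q(G)\times (G\wedge^q G)$.
   Context: Notation: ${}^g h=ghg^{-1}$ and $[g,h]=ghg^{-1}h^{-1}$. For $q\geq 1$, the $q$-tensor square $G\otimes^q G$ is the group generated by symbols $g\otimes h$ and $\{(g,g)\}$ ($g,h\in G$) subject to the following relations for all $g,h,g_1,h_1\in G$: (1) $gg_1\otimes h=({}^g g_1\otimes {}^g h)(g\otimes h)$; (2) $g\otimes hh_1=(g\otimes h)({}^h g\otimes {}^h h_1)$; (3) $\{(g,g)\}(g_1\otimes h_1)\{(g,g)\}^{-1}={}^{g^q}g_1\otimes {}^{g^q}h_1$; (4) $\{(gg_1,gg_1)\}=\{(g,g)\}\prod_{i=1}^{q-1}\big(g^{-1}\otimes({}^{g^{1-q+i}}g_1)^i\big)\{(g_1,g_1)\}$ (product in increasing order of $i$); (5) $[\{(g,g)\},\{(g_1,g_1)\}]=g^q\otimes g_1^q$; (6) $\{([g,h],[g,h])\}=(g\otimes h)^q$. For $q=0$, $G\otimes^0 G$ is the nonabelian tensor square of Brown and Loday: generators $g\otimes h$ only, subject to relations (1) and (2). $\nabla^q(G)$ is the normal subgroup of $G\otimes^q G$ generated by all $g\otimes g$, $g\in G$, and $G\wedge^q G=(G\otimes^q G)/\nabla^q(G)$. *)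

theory Defs
  imports "HOL-Algebra.Coset"
begin

section \<open>Groups given by generators and relations\<close>

text \<open>
  A word is a list of letters \<open>(x, b)\<close>, where \<open>(x, True)\<close> is the generator \<open>x\<close> and
  \<open>(x, False)\<close> its formal inverse.
\<close>

type_synonym 'x gword = "('x \<times> bool) list"

definition gwords :: "'x set \<Rightarrow> 'x gword set" where
  "gwords X = lists (X \<times> UNIV)"

definition letter :: "'x \<Rightarrow> 'x gword" where
  "letter x = [(x, True)]"

definition winv :: "'x gword \<Rightarrow> 'x gword" where
  "winv w = rev (map (\<lambda>(x, b). (x, \<not> b)) w)"

text \<open>
  The least congruence on the monoid of words over \<open>X\<close> that contains free cancellation and the
  pairs in \<open>R\<close>; a pair \<open>(u, v)\<close> stands for the relation \<open>u = v\<close>. All words involved,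
  including the intermediate ones, are words over \<open>X\<close>.
\<close>

inductive_set pres_rel :: "'x set \<Rightarrow> ('x gword \<times> 'x gword) set \<Rightarrow> ('x gword \<times> 'x gword) set"
  for X R where
  refl: "w \<in> gwords X \<Longrightarrow> (w, w) \<in> pres_rel X R"
| sym: "(u, v) \<in> pres_rel X R \<Longrightarrow> (v, u) \<in> pres_rel X R"
| trans: "(u, v) \<in> pres_rel X R \<Longrightarrow> (v, w) \<in> pres_rel X R \<Longrightarrow> (u, w) \<in> pres_rel X R"
| append: "(u, v) \<in> pres_rel X R \<Longrightarrow> (u', v') \<in> pres_rel X R \<Longrightarrow> (u @ u', v @ v') \<in> pres_rel X R"
| cancel: "x \<in> X \<Longrightarrow> ([(x, b), (x, \<not> b)], []) \<in> pres_rel X R"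
| rel: "(u, v) \<in> R \<Longrightarrow> u \<in> gwords X \<Longrightarrow> v \<in> gwords X \<Longrightarrow> (u, v) \<in> pres_rel X R"

definition presented_group :: "'x set \<Rightarrow> ('x gword \<times> 'x gword) set \<Rightarrow> 'x gword set monoid" where
  "presented_group X R =
    \<lparr>carrier = gwords X // pres_rel X R,
     mult = (\<lambda>A B. \<Union>u\<in>A. \<Union>v\<in>B. pres_rel X R `` {u @ v}),
     one = pres_rel X R `` {[]}\<rparr>"

lemma gwords_append [simp]: "u @ v \<in> gwords X \<longleftrightarrow> u \<in> gwords X \<and> v \<in> gwords X"
  by (auto simp: gwords_def)

lemma gwords_Nil [simp]: "[] \<in> gwords X"
  by (auto simp: gwords_def)

lemma winv_gwords [simp]: "winv w \<in> gwords X \<longleftrightarrow> w \<in> gwords X"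
  by (induction w) (auto simp: gwords_def winv_def)

lemma pres_rel_gwords: "(u, v) \<in> pres_rel X R \<Longrightarrow> u \<in> gwords X \<and> v \<in> gwords X"
  by (induction rule: pres_rel.induct) (auto simp: gwords_def)

lemma equiv_pres_rel: "equiv (gwords X) (pres_rel X R)"
  by (rule equivI)
     (auto simp: refl_on_def intro!: symI transI
           intro: pres_rel.refl pres_rel.sym pres_rel.trans dest: pres_rel_gwords)

lemma pres_rel_winv: "w \<in> gwords X \<Longrightarrow> (winv w @ w, []) \<in> pres_rel X R"
proof (induction w)
  case Nil
  then show ?case by (simp add: winv_def pres_rel.refl)
next
  case (Cons a w)
  obtain x b where a: "a = (x, b)" by fastforce
  have x: "x \<in> X" and w: "w \<in> gwords X" using Cons.prems a by (auto simp: gwords_def)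
  have "([(x, \<not> b), (x, b)], []) \<in> pres_rel X R"
    using pres_rel.cancel[OF x, of "\<not> b"] by simp
  moreover have "(winv w, winv w) \<in> pres_rel X R" "(w, w) \<in> pres_rel X R"
    using w by (auto intro: pres_rel.refl)
  ultimately have "((winv w @ [(x, \<not> b), (x, b)]) @ w, (winv w @ []) @ w) \<in> pres_rel X R"
    by (intro pres_rel.append)
  then have "(winv (a # w) @ (a # w), winv w @ w) \<in> pres_rel X R"
    by (simp add: winv_def a)
  then show ?case using Cons.IH[OF w] by (rule pres_rel.trans)
qed

lemma presented_mult:
  assumes "u \<in> gwords X" "v \<in> gwords X"
  shows "pres_rel X R `` {u} \<otimes>\<^bsub>presented_group X R\<^esub> pres_rel X R `` {v} = pres_rel X R `` {u @ v}"
proof -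
  have "pres_rel X R `` {u' @ v'} = pres_rel X R `` {u @ v}"
    if "(u, u') \<in> pres_rel X R" "(v, v') \<in> pres_rel X R" for u' v'
    using pres_rel.append[OF that] equiv_class_eq[OF equiv_pres_rel] by metis
  moreover have "(u, u) \<in> pres_rel X R" "(v, v) \<in> pres_rel X R"
    using assms by (auto intro: pres_rel.refl)
  ultimately have "(\<Union>u'\<in>pres_rel X R `` {u}. \<Union>v'\<in>pres_rel X R `` {v}. pres_rel X R `` {u' @ v'}) =
      pres_rel X R `` {u @ v}"
    by blast
  then show ?thesis by (simp add: presented_group_def)
qed

lemma group_presented_group: "group (presented_group X R)"
proof (rule groupI)
  let ?P = "presented_group X R" and ?c = "\<lambda>u. pres_rel X R `` {u}"
  have carr: "A \<in> carrier ?P \<longleftrightarrow> (\<exists>u\<in>gwords X. A = ?c u)" for A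
    by (auto simp: presented_group_def quotient_def)
  have one: "\<one>\<^bsub>?P\<^esub> = ?c []" by (simp add: presented_group_def)
  show "A \<otimes>\<^bsub>?P\<^esub> B \<in> carrier ?P" if "A \<in> carrier ?P" "B \<in> carrier ?P" for A B
    using that by (metis carr presented_mult gwords_append)
  show "\<one>\<^bsub>?P\<^esub> \<in> carrier ?P" unfolding carr one using gwords_Nil by blast
  show "A \<otimes>\<^bsub>?P\<^esub> B \<otimes>\<^bsub>?P\<^esub> C = A \<otimes>\<^bsub>?P\<^esub> (B \<otimes>\<^bsub>?P\<^esub> C)"
    if "A \<in> carrier ?P" "B \<in> carrier ?P" "C \<in> carrier ?P" for A B C
    using that by (auto simp: carr presented_mult)
  show "\<one>\<^bsub>?P\<^esub> \<otimes>\<^bsub>?P\<^esub> A = A" if "A \<in> carrier ?P" for A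
    using that by (auto simp: carr presented_mult one)
  show "\<exists>B\<in>carrier ?P. B \<otimes>\<^bsub>?P\<^esub> A = \<one>\<^bsub>?P\<^esub>" if A: "A \<in> carrier ?P" for A
  proof -
    obtain u where u: "u \<in> gwords X" "A = ?c u" using A carr by blast
    have "?c (winv u) \<otimes>\<^bsub>?P\<^esub> A = \<one>\<^bsub>?P\<^esub>"
      using u equiv_class_eq[OF equiv_pres_rel pres_rel_winv[OF u(1)]]
      by (simp add: presented_mult one)
    then show ?thesis using u carr winv_gwords by blast
  qed
qed

section \<open>The \<open>q\<close>-tensor square\<close>

definition conj_by :: "('a, 'b) monoid_scheme \<Rightarrow> 'a \<Rightarrow> 'a \<Rightarrow> 'a" where
  "conj_by G g h = g \<otimes>\<^bsub>G\<^esub> h \<otimes>\<^bsub>G\<^esub> inv\<^bsub>G\<^esub> g"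

definition commutator :: "('a, 'b) monoid_scheme \<Rightarrow> 'a \<Rightarrow> 'a \<Rightarrow> 'a" where
  "commutator G g h = g \<otimes>\<^bsub>G\<^esub> h \<otimes>\<^bsub>G\<^esub> inv\<^bsub>G\<^esub> g \<otimes>\<^bsub>G\<^esub> inv\<^bsub>G\<^esub> h"

text \<open>\<open>Tens g h\<close> is the symbol \<open>g \<otimes> h\<close> and \<open>Diag g\<close> the symbol \<open>{(g,g)}\<close>.\<close>

datatype 'a tensor_gen = Tens 'a 'a | Diag 'a

definition tensor_gens :: "nat \<Rightarrow> ('a, 'b) monoid_scheme \<Rightarrow> 'a tensor_gen set" where
  "tensor_gens q G =
    {Tens g h | g h. g \<in> carrier G \<and> h \<in> carrier G} \<union>
    (if q = 0 then {} else {Diag g | g. g \<in> carrier G})"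

abbreviation wtens :: "'a \<Rightarrow> 'a \<Rightarrow> 'a tensor_gen gword" where
  "wtens g h \<equiv> letter (Tens g h)"

abbreviation wdiag :: "'a \<Rightarrow> 'a tensor_gen gword" where
  "wdiag g \<equiv> letter (Diag g)"

inductive_set tensor_rels ::
  "nat \<Rightarrow> ('a, 'b) monoid_scheme \<Rightarrow> ('a tensor_gen gword \<times> 'a tensor_gen gword) set"
  for q G where
  mult_left: "\<lbrakk>g \<in> carrier G; g1 \<in> carrier G; h \<in> carrier G\<rbrakk> \<Longrightarrow>
    (wtens (g \<otimes>\<^bsub>G\<^esub> g1) h, wtens (conj_by G g g1) (conj_by G g h) @ wtens g h)
      \<in> tensor_rels q G"
| mult_right: "\<lbrakk>g \<in> carrier G; h \<in> carrier G; h1 \<in> carrier G\<rbrakk> \<Longrightarrow>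
    (wtens g (h \<otimes>\<^bsub>G\<^esub> h1), wtens g h @ wtens (conj_by G h g) (conj_by G h h1))
      \<in> tensor_rels q G"
| diag_conj: "\<lbrakk>q \<ge> 1; g \<in> carrier G; g1 \<in> carrier G; h1 \<in> carrier G\<rbrakk> \<Longrightarrow>
    (wdiag g @ wtens g1 h1 @ winv (wdiag g),
     wtens (conj_by G (g [^]\<^bsub>G\<^esub> q) g1) (conj_by G (g [^]\<^bsub>G\<^esub> q) h1))
      \<in> tensor_rels q G"
| diag_mult: "\<lbrakk>q \<ge> 1; g \<in> carrier G; g1 \<in> carrier G\<rbrakk> \<Longrightarrow>
    (wdiag (g \<otimes>\<^bsub>G\<^esub> g1),
     wdiag g @
     concat (map (\<lambda>i. wtens (inv\<^bsub>G\<^esub> g)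
                        (conj_by G (g [^]\<^bsub>G\<^esub> (1 - int q + int i)) g1 [^]\<^bsub>G\<^esub> i)) [1..<q]) @
     wdiag g1)
      \<in> tensor_rels q G"
| diag_commutator: "\<lbrakk>q \<ge> 1; g \<in> carrier G; g1 \<in> carrier G\<rbrakk> \<Longrightarrow>
    (wdiag g @ wdiag g1 @ winv (wdiag g) @ winv (wdiag g1),
     wtens (g [^]\<^bsub>G\<^esub> q) (g1 [^]\<^bsub>G\<^esub> q))
      \<in> tensor_rels q G"
| diag_of_commutator: "\<lbrakk>q \<ge> 1; g \<in> carrier G; h \<in> carrier G\<rbrakk> \<Longrightarrow>
    (wdiag (commutator G g h), concat (replicate q (wtens g h)))
      \<in> tensor_rels q G"

definition tensor_square ::
  "nat \<Rightarrow> ('a, 'b) monoid_scheme \<Rightarrow> 'a tensor_gen gword set monoid" where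
  "tensor_square q G = presented_group (tensor_gens q G) (tensor_rels q G)"

definition tens :: "nat \<Rightarrow> ('a, 'b) monoid_scheme \<Rightarrow> 'a \<Rightarrow> 'a \<Rightarrow> 'a tensor_gen gword set" where
  "tens q G g h = pres_rel (tensor_gens q G) (tensor_rels q G) `` {wtens g h}"

section \<open>The subgroup \<open>\<nabla>\<close> and the \<open>q\<close>-exterior square\<close>

definition normal_closure :: "('a, 'b) monoid_scheme \<Rightarrow> 'a set \<Rightarrow> 'a set" where
  "normal_closure G S = \<Inter>{N. N \<lhd> G \<and> S \<subseteq> N}"

definition nabla :: "nat \<Rightarrow> ('a, 'b) monoid_scheme \<Rightarrow> 'a tensor_gen gword set set" where
  "nabla q G = normal_closure (tensor_square q G) {tens q G g g | g. g \<in> carrier G}"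

definition nabla_group :: "nat \<Rightarrow> ('a, 'b) monoid_scheme \<Rightarrow> 'a tensor_gen gword set monoid" where
  "nabla_group q G = (tensor_square q G)\<lparr>carrier := nabla q G\<rparr>"

definition exterior_square ::
  "nat \<Rightarrow> ('a, 'b) monoid_scheme \<Rightarrow> 'a tensor_gen gword set set monoid" where
  "exterior_square q G = tensor_square q G Mod nabla q G"

lemma (in group) normal_closure_normal:
  assumes "S \<subseteq> carrier G"
  shows "normal_closure G S \<lhd> G"
proof -
  have G: "carrier G \<lhd> G"
    by (rule normal_invI[OF subgroup_self]) simp
  have "subgroup (normal_closure G S) G"
    unfolding normal_closure_def using G assms
    by (intro subgroups_Inter) (auto dest: normal_imp_subgroup)
  then show ?thesis
    by (rule normal_invI) (auto simp: normal_closure_def dest: normal_invE(2))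
qed

lemma group_tensor_square: "group (tensor_square q G)"
  by (simp add: tensor_square_def group_presented_group)

lemma tens_closed:
  "g \<in> carrier G \<Longrightarrow> h \<in> carrier G \<Longrightarrow> tens q G g h \<in> carrier (tensor_square q G)"
  unfolding tens_def tensor_square_def presented_group_def
  by (auto intro!: quotientI simp: gwords_def letter_def tensor_gens_def)

lemma nabla_normal: "nabla q G \<lhd> tensor_square q G"
  unfolding nabla_def
  by (intro group.normal_closure_normal group_tensor_square) (auto intro: tens_closed)

end

theory Submission
  imports Defs
begin

text \<open>
  Write \<open>T\<close> for the \<open>q\<close>-tensor square and \<open>\<nabla>\<close> for the normal closure of the diagonal
  elements \<open>g \<otimes> g\<close>. It suffices to find a homomorphism \<open>\<phi> : T \<rightarrow> \<nabla>\<close> that is the identity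
  on \<open>\<nabla>\<close>: then \<open>t \<mapsto> (\<phi> t, \<nabla>t)\<close> is an isomorphism onto \<open>\<nabla> \<times> T/\<nabla>\<close>
  (lemma \<open>normal_retract_iso\<close>).

  The relations \<open>mult_left\<close> and \<open>mult_right\<close> alone imply that a diagonal element commutes with
  all tensors (\<open>self_commute\<close>) and does not change when its argument is conjugated
  (\<open>self_conj\<close>). The relation \<open>diag_conj\<close> then makes it commute with the symbols \<open>{(g,g)}\<close> as
  well, so \<open>\<nabla>\<close> is central. The relations \<open>mult_left\<close> and \<open>mult_right\<close> also imply that
  \<open>\<langle>g,h\<rangle> = (g \<otimes> h)(h \<otimes> g)\<close> equals \<open>(gh \<otimes> gh)(g \<otimes> g)\<inverse>(h \<otimes> h)\<inverse>\<close> and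
  is a symmetric bilinear pairing with values in \<open>\<nabla>\<close>, where
  \<open>\<langle>g,g\<rangle> = (g \<otimes> g)\<^sup>2\<close>. Since \<open>\<nabla>\<close> is abelian and generated by elements killed by the
  odd number \<open>k\<close>, squaring can be undone on it: with \<open>m = (k + 1) div 2\<close>, the \<open>m\<close>-th power of
  \<open>\<langle>g,g\<rangle>\<close> is \<open>g \<otimes> g\<close>. This suggests sending \<open>g \<otimes> h\<close> to the \<open>m\<close>-th power of
  \<open>\<langle>g,h\<rangle>\<close>, which is the only choice symmetric in \<open>g\<close> and \<open>h\<close> for a map that fixes \<open>\<nabla>\<close>.

  For \<open>q \<ge> 1\<close> the symbols \<open>{(g,g)}\<close> can all be sent to \<open>1\<close>. The reason is that \<open>\<nabla>\<close> is also
  killed by \<open>q\<close>: the relation \<open>diag_of_commutator\<close> with \<open>h = g\<close> says that the \<open>q\<close>-th power of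
  \<open>g \<otimes> g\<close> is \<open>{(1,1)}\<close>, which is trivial by \<open>diag_mult\<close>. In \<open>diag_commutator\<close> and
  \<open>diag_of_commutator\<close> the tensor side therefore maps to a power with exponent divisible by \<open>q\<close>.
  In \<open>diag_mult\<close> the product of tensors maps to a power with exponent \<open>m(1 + ... + (q-1))\<close>, twice
  which is divisible by \<open>q\<close>; as \<open>\<nabla>\<close> has no element of order two, this power is trivial too.
\<close>

section \<open>Conjugation\<close>

context group
begin

lemma conj_by_closed [simp, intro]:
  "g \<in> carrier G \<Longrightarrow> x \<in> carrier G \<Longrightarrow> conj_by G g x \<in> carrier G"
  by (simp add: conj_by_def)

lemma conj_by_one [simp]: "x \<in> carrier G \<Longrightarrow> conj_by G \<one> x = x"
  by (simp add: conj_by_def)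

lemma conj_by_self [simp]: "x \<in> carrier G \<Longrightarrow> conj_by G x x = x"
  by (simp add: conj_by_def m_assoc)

lemma conj_by_mult:
  "\<lbrakk>g \<in> carrier G; x \<in> carrier G; y \<in> carrier G\<rbrakk> \<Longrightarrow>
    conj_by G g (x \<otimes> y) = conj_by G g x \<otimes> conj_by G g y"
  by (simp add: conj_by_def m_assoc inv_solve_left)

lemma conj_by_conj_by:
  "\<lbrakk>g \<in> carrier G; h \<in> carrier G; x \<in> carrier G\<rbrakk> \<Longrightarrow>
    conj_by G g (conj_by G h x) = conj_by G (g \<otimes> h) x"
  by (simp add: conj_by_def m_assoc inv_mult_group)

lemma conj_by_mult_right:
  "\<lbrakk>g \<in> carrier G; x \<in> carrier G\<rbrakk> \<Longrightarrow> conj_by G g x \<otimes> g = g \<otimes> x"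
  by (simp add: conj_by_def m_assoc)

lemma conj_by_eq_iff_commute:
  "\<lbrakk>g \<in> carrier G; x \<in> carrier G\<rbrakk> \<Longrightarrow> conj_by G g x = x \<longleftrightarrow> g \<otimes> x = x \<otimes> g"
  by (metis conj_by_closed conj_by_mult_right right_cancel)

text \<open>
  In terms of conjugation the centralizer is a stabilizer, for which closure is immediate.
\<close>

lemma subgroup_centralizer:
  assumes [simp]: "x \<in> carrier G"
  shows "subgroup {g \<in> carrier G. g \<otimes> x = x \<otimes> g} G"
proof -
  let ?C = "{g \<in> carrier G. conj_by G g x = x}"
  have "subgroup ?C G"
  proof (rule subgroupI)
    fix u assume u: "u \<in> ?C"
    then show "inv u \<in> ?C" using conj_by_conj_by[of "inv u" u x] by simp
  next
    fix u v assume u: "u \<in> ?C" and v: "v \<in> ?C"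
    then have "conj_by G (u \<otimes> v) x = conj_by G u (conj_by G v x)"
      by (simp add: conj_by_conj_by[of u v x, symmetric])
    then show "u \<otimes> v \<in> ?C" using u v by simp
  qed (auto intro!: exI[of _ \<one>])
  moreover have "?C = {g \<in> carrier G. g \<otimes> x = x \<otimes> g}"
    by (auto simp: conj_by_eq_iff_commute)
  ultimately show ?thesis by simp
qed

lemma subgroup_center: "subgroup {x \<in> carrier G. \<forall>g\<in>carrier G. g \<otimes> x = x \<otimes> g} G"
proof -
  have "{x \<in> carrier G. \<forall>g\<in>carrier G. g \<otimes> x = x \<otimes> g} =
      \<Inter> ((\<lambda>g. {x \<in> carrier G. x \<otimes> g = g \<otimes> x}) ` carrier G)"
    by auto
  then show ?thesis
    by (auto intro!: subgroups_Inter subgroup_centralizer)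
qed

lemma central_subgroup_normal:
  assumes N: "subgroup N G"
    and central: "\<And>x g. x \<in> N \<Longrightarrow> g \<in> carrier G \<Longrightarrow> g \<otimes> x = x \<otimes> g"
  shows "N \<lhd> G"
proof (rule normal_invI[OF N])
  fix g x assume "g \<in> carrier G" "x \<in> N"
  then show "g \<otimes> x \<otimes> inv g \<in> N"
    using central[of x g] subgroup.mem_carrier[OF N] by (simp add: m_assoc)
qed

end

section \<open>Crossed pairings\<close>

text \<open>
  The relations \<open>mult_left\<close> and \<open>mult_right\<close> of the tensor square, for a map into an arbitrary
  group: a map of this kind is what Brown and Loday call a crossed pairing. The symmetric pairing
  is constructed at this level, where all \<open>q\<close> behave alike.
\<close>

locale crossed_pairing = G: group G + T: group T
  for G (structure) and T (structure) +
  fixes s :: "'a \<Rightarrow> 'a \<Rightarrow> 'c"  (infixl "\<odot>" 75)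
  assumes s_closed [simp, intro]:
      "g \<in> carrier G \<Longrightarrow> h \<in> carrier G \<Longrightarrow> g \<odot> h \<in> carrier T"
    and s_mult_left:
      "\<lbrakk>g \<in> carrier G; g1 \<in> carrier G; h \<in> carrier G\<rbrakk> \<Longrightarrow>
        (g \<otimes>\<^bsub>G\<^esub> g1) \<odot> h = (conj_by G g g1 \<odot> conj_by G g h) \<otimes>\<^bsub>T\<^esub> (g \<odot> h)"
    and s_mult_right:
      "\<lbrakk>g \<in> carrier G; h \<in> carrier G; h1 \<in> carrier G\<rbrakk> \<Longrightarrow>
        g \<odot> (h \<otimes>\<^bsub>G\<^esub> h1) = (g \<odot> h) \<otimes>\<^bsub>T\<^esub> (conj_by G h g \<odot> conj_by G h h1)"
begin

lemma s_one_right [simp]: "g \<in> carrier G \<Longrightarrow> g \<odot> \<one>\<^bsub>G\<^esub> = \<one>\<^bsub>T\<^esub>"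
  using s_mult_right[of g "\<one>\<^bsub>G\<^esub>" "\<one>\<^bsub>G\<^esub>"] by simp

text \<open>
  Expanding \<open>gx \<odot> hy\<close> by either rule first gives the same outer factors; cancelling them leaves
  this identity.
\<close>

lemma s_exchange:
  assumes [simp]: "g \<in> carrier G" "h \<in> carrier G" "x \<in> carrier G" "y \<in> carrier G"
  shows "(conj_by G (g \<otimes>\<^bsub>G\<^esub> h) x \<odot> conj_by G (g \<otimes>\<^bsub>G\<^esub> h) y) \<otimes>\<^bsub>T\<^esub> (g \<odot> h)
    = (g \<odot> h) \<otimes>\<^bsub>T\<^esub> (conj_by G (h \<otimes>\<^bsub>G\<^esub> g) x \<odot> conj_by G (h \<otimes>\<^bsub>G\<^esub> g) y)"
proof -
  let ?a = "conj_by G g x \<odot> conj_by G g h" and ?b = "conj_by G h g \<odot> conj_by G h y"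
  let ?L = "conj_by G (g \<otimes>\<^bsub>G\<^esub> h) x \<odot> conj_by G (g \<otimes>\<^bsub>G\<^esub> h) y"
  let ?R = "conj_by G (h \<otimes>\<^bsub>G\<^esub> g) x \<odot> conj_by G (h \<otimes>\<^bsub>G\<^esub> g) y"
  have gh: "conj_by G g h \<otimes>\<^bsub>G\<^esub> g = g \<otimes>\<^bsub>G\<^esub> h" "conj_by G h g \<otimes>\<^bsub>G\<^esub> h = h \<otimes>\<^bsub>G\<^esub> g"
    by (simp_all add: G.conj_by_mult_right)
  have "(g \<otimes>\<^bsub>G\<^esub> x) \<odot> (h \<otimes>\<^bsub>G\<^esub> y) = ?a \<otimes>\<^bsub>T\<^esub> ?L \<otimes>\<^bsub>T\<^esub> ((g \<odot> h) \<otimes>\<^bsub>T\<^esub> ?b)"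
    using s_mult_left[of g x "h \<otimes>\<^bsub>G\<^esub> y"]
    by (simp add: s_mult_right[of "conj_by G g x"] s_mult_right[of g h y] G.conj_by_mult
        G.conj_by_conj_by gh)
  moreover have "(g \<otimes>\<^bsub>G\<^esub> x) \<odot> (h \<otimes>\<^bsub>G\<^esub> y) = ?a \<otimes>\<^bsub>T\<^esub> (g \<odot> h) \<otimes>\<^bsub>T\<^esub> (?R \<otimes>\<^bsub>T\<^esub> ?b)"
    using s_mult_right[of "g \<otimes>\<^bsub>G\<^esub> x" h y]
    by (simp add: s_mult_left[of g x h] s_mult_left[of "conj_by G h g"] G.conj_by_mult
        G.conj_by_conj_by gh)
  ultimately have "?a \<otimes>\<^bsub>T\<^esub> ((?L \<otimes>\<^bsub>T\<^esub> (g \<odot> h)) \<otimes>\<^bsub>T\<^esub> ?b) = ?a \<otimes>\<^bsub>T\<^esub> (((g \<odot> h) \<otimes>\<^bsub>T\<^esub> ?R) \<otimes>\<^bsub>T\<^esub> ?b)"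
    by (simp add: T.m_assoc)
  then show ?thesis by simp
qed

text \<open>
  For \<open>h = g\<close> both conjugating elements in the exchange identity are \<open>gg\<close>, and every pair of
  arguments is a conjugate by \<open>gg\<close>.
\<close>

lemma self_commute:
  assumes [simp]: "y \<in> carrier G" "g \<in> carrier G" "h \<in> carrier G"
  shows "(y \<odot> y) \<otimes>\<^bsub>T\<^esub> (g \<odot> h) = (g \<odot> h) \<otimes>\<^bsub>T\<^esub> (y \<odot> y)"
  using s_exchange[of y y "conj_by G (inv\<^bsub>G\<^esub> (y \<otimes>\<^bsub>G\<^esub> y)) g" "conj_by G (inv\<^bsub>G\<^esub> (y \<otimes>\<^bsub>G\<^esub> y)) h"]
  by (simp add: G.conj_by_conj_by)

text \<open>
  Compare the expansions of \<open>y \<odot> ay\<close> and \<open>y \<odot> y(y\<inverse>ay)\<close>, using that \<open>y \<odot> y\<close>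
  commutes with \<open>y \<odot> a\<close>.
\<close>

lemma self_conj:
  assumes [simp]: "a \<in> carrier G" "y \<in> carrier G"
  shows "conj_by G a y \<odot> conj_by G a y = y \<odot> y"
proof -
  have "(y \<odot> a) \<otimes>\<^bsub>T\<^esub> (conj_by G a y \<odot> conj_by G a y) = y \<odot> (a \<otimes>\<^bsub>G\<^esub> y)"
    by (simp add: s_mult_right)
  also have "a \<otimes>\<^bsub>G\<^esub> y = y \<otimes>\<^bsub>G\<^esub> conj_by G (inv\<^bsub>G\<^esub> y) a"
    by (simp add: conj_by_def flip: G.m_assoc)
  also have "y \<odot> \<dots> = (y \<odot> y) \<otimes>\<^bsub>T\<^esub> (y \<odot> a)"
    by (simp add: s_mult_right G.conj_by_conj_by)
  also have "\<dots> = (y \<odot> a) \<otimes>\<^bsub>T\<^esub> (y \<odot> y)"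
    by (simp add: self_commute)
  finally show ?thesis by simp
qed

text \<open>
  By \<open>sym_pair_eq\<close> this is the polarization of the quadratic map \<open>g \<mapsto> g \<odot> g\<close>; below it is
  written \<open>\<langle>g,h\<rangle>\<close>.
\<close>

definition sym_pair :: "'a \<Rightarrow> 'a \<Rightarrow> 'c" where
  "sym_pair g h = (g \<odot> h) \<otimes>\<^bsub>T\<^esub> (h \<odot> g)"

lemma sym_pair_closed [simp, intro]:
  "g \<in> carrier G \<Longrightarrow> h \<in> carrier G \<Longrightarrow> sym_pair g h \<in> carrier T"
  by (simp add: sym_pair_def)

lemma sym_pair_self: "sym_pair g g = (g \<odot> g) \<otimes>\<^bsub>T\<^esub> (g \<odot> g)"
  by (simp add: sym_pair_def)

text \<open>
  Conjugation by \<open>g\<close> appears when \<open>gh' \<odot> gh'\<close> is expanded. Writing the product \<open>hg\<close> as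
  \<open>gh'\<close> with \<open>h' = g\<inverse>hg\<close> absorbs it.
\<close>

lemma self_mult:
  assumes [simp]: "g \<in> carrier G" "h \<in> carrier G"
  shows "(h \<otimes>\<^bsub>G\<^esub> g) \<odot> (h \<otimes>\<^bsub>G\<^esub> g) = sym_pair h g \<otimes>\<^bsub>T\<^esub> ((g \<odot> g) \<otimes>\<^bsub>T\<^esub> (h \<odot> h))"
proof -
  define h' where "h' = conj_by G (inv\<^bsub>G\<^esub> g) h"
  have [simp]: "h' \<in> carrier G" by (simp add: h'_def)
  have c: "conj_by G g h' = h" by (simp add: h'_def G.conj_by_conj_by)
  have hg: "h \<otimes>\<^bsub>G\<^esub> g = g \<otimes>\<^bsub>G\<^esub> h'"
    by (simp add: h'_def conj_by_def flip: G.m_assoc)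
  have "(h \<otimes>\<^bsub>G\<^esub> g) \<odot> (h \<otimes>\<^bsub>G\<^esub> g) = (h \<odot> (g \<otimes>\<^bsub>G\<^esub> h)) \<otimes>\<^bsub>T\<^esub> (g \<odot> (g \<otimes>\<^bsub>G\<^esub> h'))"
    unfolding hg by (simp add: s_mult_left[of g h'] G.conj_by_mult c)
  also have "\<dots> = (h \<odot> g) \<otimes>\<^bsub>T\<^esub> (h \<odot> h) \<otimes>\<^bsub>T\<^esub> ((g \<odot> g) \<otimes>\<^bsub>T\<^esub> (g \<odot> h))"
    by (simp add: s_mult_right c self_conj)
  also have "\<dots> = (h \<odot> g) \<otimes>\<^bsub>T\<^esub> ((h \<odot> h) \<otimes>\<^bsub>T\<^esub> (g \<odot> h)) \<otimes>\<^bsub>T\<^esub> (g \<odot> g)"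
    by (simp add: T.m_assoc self_commute[of g g h])
  also have "\<dots> = sym_pair h g \<otimes>\<^bsub>T\<^esub> ((h \<odot> h) \<otimes>\<^bsub>T\<^esub> (g \<odot> g))"
    unfolding self_commute[OF assms(2,1,2)] by (simp add: sym_pair_def T.m_assoc)
  finally show ?thesis by (simp add: self_commute[of h g g])
qed

lemma sym_pair_eq:
  assumes [simp]: "g \<in> carrier G" "h \<in> carrier G"
  shows "sym_pair h g = ((h \<otimes>\<^bsub>G\<^esub> g) \<odot> (h \<otimes>\<^bsub>G\<^esub> g)) \<otimes>\<^bsub>T\<^esub> inv\<^bsub>T\<^esub> ((g \<odot> g) \<otimes>\<^bsub>T\<^esub> (h \<odot> h))"
  by (simp add: self_mult T.m_assoc)

lemma sym_pair_commute:
  assumes [simp]: "g \<in> carrier G" "h \<in> carrier G" "x \<in> carrier G" "y \<in> carrier G"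
  shows "sym_pair g h \<otimes>\<^bsub>T\<^esub> (x \<odot> y) = (x \<odot> y) \<otimes>\<^bsub>T\<^esub> sym_pair g h"
proof -
  let ?d = "(g \<odot> g) \<otimes>\<^bsub>T\<^esub> (h \<odot> h)" and ?t = "x \<odot> y"
  have d: "?d \<otimes>\<^bsub>T\<^esub> ?t = ?t \<otimes>\<^bsub>T\<^esub> ?d"
    by (metis T.m_assoc assms self_commute s_closed)
  have "sym_pair g h \<otimes>\<^bsub>T\<^esub> ?t \<otimes>\<^bsub>T\<^esub> ((h \<odot> h) \<otimes>\<^bsub>T\<^esub> (g \<odot> g))
    = ?t \<otimes>\<^bsub>T\<^esub> sym_pair g h \<otimes>\<^bsub>T\<^esub> ((h \<odot> h) \<otimes>\<^bsub>T\<^esub> (g \<odot> g))"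
    using self_commute[of "g \<otimes>\<^bsub>G\<^esub> h" x y] self_mult[of h g] d self_commute[of g h h]
    by (simp add: T.m_assoc)
  then show ?thesis by simp
qed

lemma sym_pair_commute_sym_pair:
  assumes "g \<in> carrier G" "h \<in> carrier G" "x \<in> carrier G" "y \<in> carrier G"
  shows "sym_pair g h \<otimes>\<^bsub>T\<^esub> sym_pair x y = sym_pair x y \<otimes>\<^bsub>T\<^esub> sym_pair g h"
  using assms unfolding sym_pair_def[of x y]
  by (metis T.m_assoc s_closed sym_pair_closed sym_pair_commute)

text \<open>
  With \<open>a = g \<odot> h\<close> and \<open>b = h \<odot> g\<close>, cancel \<open>a\<close> in \<open>a(ba) = (ab)a = a(ab)\<close>.
\<close>

lemma sym_pair_swap:
  assumes [simp]: "g \<in> carrier G" "h \<in> carrier G"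
  shows "sym_pair g h = sym_pair h g"
proof -
  have "(g \<odot> h) \<otimes>\<^bsub>T\<^esub> sym_pair h g = sym_pair g h \<otimes>\<^bsub>T\<^esub> (g \<odot> h)"
    by (simp add: sym_pair_def T.m_assoc)
  also have "\<dots> = (g \<odot> h) \<otimes>\<^bsub>T\<^esub> sym_pair g h"
    by (simp add: sym_pair_commute)
  finally show ?thesis by simp
qed

lemma sym_pair_conj_both:
  assumes [simp]: "a \<in> carrier G" "g \<in> carrier G" "h \<in> carrier G"
  shows "sym_pair (conj_by G a g) (conj_by G a h) = sym_pair g h"
  by (simp add: sym_pair_eq self_conj flip: G.conj_by_mult)

text \<open>
  The two expansions of \<open>gg\<^sub>1 \<odot> h\<close> and \<open>h \<odot> gg\<^sub>1\<close> nest around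
  \<open>\<langle>g,h\<rangle>\<close>, which can be moved out because it commutes with tensors; what is left is
  \<open>\<langle>g\<^sub>1,h\<rangle>\<close> conjugated in both arguments.
\<close>

lemma sym_pair_mult_left:
  assumes [simp]: "g \<in> carrier G" "g1 \<in> carrier G" "h \<in> carrier G"
  shows "sym_pair (g \<otimes>\<^bsub>G\<^esub> g1) h = sym_pair g1 h \<otimes>\<^bsub>T\<^esub> sym_pair g h"
proof -
  let ?x = "conj_by G g g1" and ?y = "conj_by G g h"
  have "sym_pair (g \<otimes>\<^bsub>G\<^esub> g1) h = (?x \<odot> ?y) \<otimes>\<^bsub>T\<^esub> (sym_pair g h \<otimes>\<^bsub>T\<^esub> (?y \<odot> ?x))"
    by (simp add: sym_pair_def s_mult_left s_mult_right T.m_assoc)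
  also have "\<dots> = sym_pair ?x ?y \<otimes>\<^bsub>T\<^esub> sym_pair g h"
    by (simp add: sym_pair_commute) (simp add: sym_pair_def T.m_assoc)
  finally show ?thesis by (simp add: sym_pair_conj_both)
qed

lemma sym_pair_mult_right:
  assumes [simp]: "g \<in> carrier G" "h1 \<in> carrier G" "h \<in> carrier G"
  shows "sym_pair g (h \<otimes>\<^bsub>G\<^esub> h1) = sym_pair g h \<otimes>\<^bsub>T\<^esub> sym_pair g h1"
  by (simp add: sym_pair_swap[of g] sym_pair_mult_left sym_pair_commute_sym_pair)

lemma sym_pair_one_right [simp]: "g \<in> carrier G \<Longrightarrow> sym_pair g \<one>\<^bsub>G\<^esub> = \<one>\<^bsub>T\<^esub>"
  using sym_pair_mult_right[of g "\<one>\<^bsub>G\<^esub>" "\<one>\<^bsub>G\<^esub>"] by simp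

text \<open>
  Bilinear maps with commuting values are class functions of each argument.
\<close>

lemma sym_pair_conj_right:
  assumes [simp]: "a \<in> carrier G" "g \<in> carrier G" "h \<in> carrier G"
  shows "sym_pair g (conj_by G a h) = sym_pair g h"
proof -
  have "sym_pair g (conj_by G a h) \<otimes>\<^bsub>T\<^esub> sym_pair g a = sym_pair g (a \<otimes>\<^bsub>G\<^esub> h)"
    by (simp add: G.conj_by_mult_right flip: sym_pair_mult_right)
  also have "\<dots> = sym_pair g h \<otimes>\<^bsub>T\<^esub> sym_pair g a"
    by (simp add: sym_pair_mult_right sym_pair_commute_sym_pair)
  finally show ?thesis by simp
qed

lemma sym_pair_pow_right:
  assumes [simp]: "g \<in> carrier G" "h \<in> carrier G"
  shows "sym_pair g (h [^]\<^bsub>G\<^esub> (n::nat)) = sym_pair g h [^]\<^bsub>T\<^esub> n"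
  by (induction n) (simp_all add: sym_pair_mult_right)

end

section \<open>Homomorphisms out of a presented group\<close>

primrec word_value :: "('c, 'd) monoid_scheme \<Rightarrow> ('x \<Rightarrow> 'c) \<Rightarrow> 'x gword \<Rightarrow> 'c" where
  "word_value H f [] = \<one>\<^bsub>H\<^esub>"
| "word_value H f (a # w) =
    (if snd a then f (fst a) else inv\<^bsub>H\<^esub> f (fst a)) \<otimes>\<^bsub>H\<^esub> word_value H f w"

lemma (in group) word_value_closed:
  "f \<in> X \<rightarrow> carrier G \<Longrightarrow> w \<in> gwords X \<Longrightarrow> word_value G f w \<in> carrier G"
  by (induction w) (auto simp: gwords_def Pi_iff)

lemma (in group) word_value_append:
  "f \<in> X \<rightarrow> carrier G \<Longrightarrow> u \<in> gwords X \<Longrightarrow> v \<in> gwords X \<Longrightarrow>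
    word_value G f (u @ v) = word_value G f u \<otimes> word_value G f v"
proof (induction u)
  case Nil
  then show ?case by (simp add: word_value_closed)
next
  case (Cons a u)
  from Cons.prems have "fst a \<in> X" "u \<in> gwords X" by (auto simp: gwords_def)
  with Cons show ?case
    by (auto simp: m_assoc word_value_closed Pi_iff)
qed

text \<open>Von Dyck: the words on which two values agree form a congruence.\<close>

lemma (in group) hom_from_presented_group:
  assumes f: "f \<in> X \<rightarrow> carrier G"
    and R: "\<And>u v. (u, v) \<in> R \<Longrightarrow> word_value G f u = word_value G f v"
  obtains \<phi> where "\<phi> \<in> hom (presented_group X R) G"
    and "\<And>w. w \<in> gwords X \<Longrightarrow> \<phi> (pres_rel X R `` {w}) = word_value G f w"
proof
  let ?\<phi> = "\<lambda>A. word_value G f (SOME w. w \<in> A)"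
  have eq: "word_value G f u = word_value G f v" if "(u, v) \<in> pres_rel X R" for u v
    using that
  proof induction
    case (append u v u' v')
    then show ?case using pres_rel_gwords by (metis f word_value_append)
  next
    case (cancel x b)
    then show ?case using f by (auto simp: Pi_iff)
  qed (auto simp: R)
  show val: "?\<phi> (pres_rel X R `` {w}) = word_value G f w" if "w \<in> gwords X" for w
  proof -
    have "w \<in> pres_rel X R `` {w}" using that by (auto intro: pres_rel.refl)
    then have "(SOME u. u \<in> pres_rel X R `` {w}) \<in> pres_rel X R `` {w}" by (rule someI)
    then show ?thesis using eq by fastforce
  qed
  have carr: "\<exists>w\<in>gwords X. A = pres_rel X R `` {w}" if "A \<in> carrier (presented_group X R)" for A
    using that by (auto simp: presented_group_def quotient_def)
  show "?\<phi> \<in> hom (presented_group X R) G"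
  proof (rule homI)
    fix A assume "A \<in> carrier (presented_group X R)"
    then show "?\<phi> A \<in> carrier G" using carr[of A] val f word_value_closed by metis
  next
    fix A B assume "A \<in> carrier (presented_group X R)" "B \<in> carrier (presented_group X R)"
    then obtain u v where "u \<in> gwords X" "A = pres_rel X R `` {u}"
        "v \<in> gwords X" "B = pres_rel X R `` {v}" using carr by metis
    then show "?\<phi> (A \<otimes>\<^bsub>presented_group X R\<^esub> B) = ?\<phi> A \<otimes> ?\<phi> B"
      using f val gwords_append by (metis presented_mult word_value_append)
  qed
qed

lemma presented_group_generated:
  assumes H: "subgroup H (presented_group X R)"
    and X: "\<And>x. x \<in> X \<Longrightarrow> pres_rel X R `` {letter x} \<in> H"
  shows "carrier (presented_group X R) \<subseteq> H"
proof -
  let ?P = "presented_group X R" and ?c = "\<lambda>u. pres_rel X R `` {u}"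
  interpret P: group ?P by (rule group_presented_group)
  have carr: "?c u \<in> carrier ?P" if "u \<in> gwords X" for u
    using that by (auto simp: presented_group_def quotient_def)
  have one: "?c [] = \<one>\<^bsub>?P\<^esub>" by (simp add: presented_group_def)
  have letters: "?c [(x, b)] \<in> H" if x: "x \<in> X" for x b
  proof (cases b)
    case True
    then show ?thesis using X[OF x] by (simp add: letter_def)
  next
    case False
    have w: "[(x, True)] \<in> gwords X" "[(x, False)] \<in> gwords X" using x by (auto simp: gwords_def)
    have "?c [(x, False)] \<otimes>\<^bsub>?P\<^esub> ?c [(x, True)] = \<one>\<^bsub>?P\<^esub>"
      using equiv_class_eq[OF equiv_pres_rel pres_rel.cancel[OF x, of False]] w
      by (simp add: presented_mult flip: one)
    then have "?c [(x, False)] = inv\<^bsub>?P\<^esub> ?c [(x, True)]"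
      using carr w by (metis P.inv_equality P.inv_inv)
    then show ?thesis
      using X[OF x] False subgroup.m_inv_closed[OF H] by (simp add: letter_def)
  qed
  have "?c w \<in> H" if "w \<in> gwords X" for w
    using that
  proof (induction w)
    case Nil
    then show ?case by (simp add: one subgroup.one_closed[OF H])
  next
    case (Cons a w)
    then have a: "fst a \<in> X" "[a] \<in> gwords X" "w \<in> gwords X" by (auto simp: gwords_def)
    have "?c [a] \<otimes>\<^bsub>?P\<^esub> ?c w \<in> H"
      using Cons.IH a letters[of "fst a" "snd a"] by (auto intro: subgroup.m_closed[OF H])
    then show ?case using presented_mult[OF a(2,3)] by simp
  qed
  then show ?thesis by (auto simp: presented_group_def quotient_def)
qed

lemma presented_relation:
  assumes "(u, v) \<in> R" "u \<in> gwords X" "v \<in> gwords X"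
  shows "pres_rel X R `` {u} = pres_rel X R `` {v}"
  by (rule equiv_class_eq[OF equiv_pres_rel pres_rel.rel[OF assms]])

section \<open>Retracts\<close>

text \<open>
  Elements of the same coset differ by some \<open>n \<in> N\<close>, and equal values under \<open>\<phi>\<close> force
  \<open>n = 1\<close>, so \<open>t \<mapsto> (\<phi> t, Nt)\<close> is injective; the pair \<open>(n, Nt)\<close> is the image of
  \<open>n(\<phi> t)\<inverse>t\<close>.
\<close>

lemma (in group) normal_retract_iso:
  assumes N: "N \<lhd> G"
    and hom: "\<phi> \<in> hom G (G\<lparr>carrier := N\<rparr>)"
    and id: "\<And>n. n \<in> N \<Longrightarrow> \<phi> n = n"
  shows "G \<cong> G\<lparr>carrier := N\<rparr> \<times>\<times> (G Mod N)"
proof -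
  interpret N: normal N G by (rule N)
  have \<phi>N [simp]: "\<phi> t \<in> N" if "t \<in> carrier G" for t
    using hom that by (auto simp: hom_def)
  have \<phi>mult [simp]: "\<phi> (t \<otimes> u) = \<phi> t \<otimes> \<phi> u" if "t \<in> carrier G" "u \<in> carrier G" for t u
    using hom that by (auto simp: hom_def)
  let ?\<psi> = "\<lambda>t. (\<phi> t, N #> t)"
  have "?\<psi> \<in> hom G (G\<lparr>carrier := N\<rparr> \<times>\<times> (G Mod N))"
    by (rule homI) (auto simp: FactGroup_def RCOSETS_def N.rcos_sum)
  moreover have "inj_on ?\<psi> (carrier G)"
  proof (rule inj_onI)
    fix t u assume t: "t \<in> carrier G" and u: "u \<in> carrier G" and eq: "?\<psi> t = ?\<psi> u"
    have "t \<in> N #> u" using eq t N.subgroup_axioms by (metis prod.inject rcos_self)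
    then obtain n where n: "n \<in> N" "t = n \<otimes> u" by (auto simp: r_coset_def)
    then have "n \<otimes> \<phi> u = \<phi> u" using eq u id[of n] by (simp add: N.mem_carrier)
    then have "n = \<one>" using n u by (simp add: N.mem_carrier)
    then show "t = u" using n u by simp
  qed
  moreover have "p \<in> ?\<psi> ` carrier G" if p: "p \<in> carrier (G\<lparr>carrier := N\<rparr> \<times>\<times> (G Mod N))" for p
  proof -
    obtain n t where n: "n \<in> N" and t: "t \<in> carrier G" and p: "p = (n, N #> t)"
      using p by (auto simp: FactGroup_def RCOSETS_def)
    let ?n = "n \<otimes> inv (\<phi> t)"
    have nN: "?n \<in> N" using n t by simp
    then have "\<phi> (?n \<otimes> t) = n" using n t id[OF nN] \<phi>mult[of ?n t]
      by (simp add: N.mem_carrier m_assoc del: \<phi>mult)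
    moreover have "N #> (?n \<otimes> t) = N #> t"
      using nN t by (metis N.subset coset_mult_assoc N.mem_carrier N.rcos_const is_group)
    ultimately show ?thesis using p nN t
      by (intro image_eqI[of _ _ "?n \<otimes> t"]) (auto simp: N.mem_carrier)
  qed
  ultimately have "?\<psi> \<in> iso G (G\<lparr>carrier := N\<rparr> \<times>\<times> (G Mod N))"
    unfolding iso_def bij_betw_def by (auto simp: hom_def)
  then show ?thesis by (rule is_isoI)
qed

section \<open>The tensor square\<close>

context
  fixes q :: nat and G :: "('a, 'b) monoid_scheme"
  assumes G: "group G"
begin

interpretation G: group G by (rule G)

abbreviation (input) "T \<equiv> tensor_square q G"
abbreviation (input) "cls \<equiv> \<lambda>w. pres_rel (tensor_gens q G) (tensor_rels q G) `` {w}"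

interpretation T: group T by (rule group_tensor_square)

lemma wtens_gwords [simp]:
  "g \<in> carrier G \<Longrightarrow> h \<in> carrier G \<Longrightarrow> wtens g h \<in> gwords (tensor_gens q G)"
  by (auto simp: gwords_def letter_def tensor_gens_def)

lemma wdiag_gwords [simp]: "1 \<le> q \<Longrightarrow> g \<in> carrier G \<Longrightarrow> wdiag g \<in> gwords (tensor_gens q G)"
  by (auto simp: gwords_def letter_def tensor_gens_def)

lemma cls_append:
  "u \<in> gwords (tensor_gens q G) \<Longrightarrow> v \<in> gwords (tensor_gens q G) \<Longrightarrow>
    cls (u @ v) = cls u \<otimes>\<^bsub>T\<^esub> cls v"
  by (simp add: tensor_square_def presented_mult)

lemma cls_closed: "w \<in> gwords (tensor_gens q G) \<Longrightarrow> cls w \<in> carrier T"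
  by (auto simp: tensor_square_def presented_group_def intro: quotientI)

lemma cls_Nil: "cls [] = \<one>\<^bsub>T\<^esub>"
  by (simp add: tensor_square_def presented_group_def)

lemma cls_winv:
  assumes "w \<in> gwords (tensor_gens q G)"
  shows "cls (winv w) = inv\<^bsub>T\<^esub> cls w"
proof -
  have "cls (winv w) \<otimes>\<^bsub>T\<^esub> cls w = \<one>\<^bsub>T\<^esub>"
    using assms equiv_class_eq[OF equiv_pres_rel pres_rel_winv[OF assms]]
    by (simp add: cls_append[symmetric] cls_Nil[symmetric])
  then show ?thesis using assms by (metis T.inv_equality cls_closed winv_gwords)
qed

lemma crossed_pairing_tens: "crossed_pairing G T (tens q G)"
proof (unfold_locales)
  show "tens q G (g \<otimes>\<^bsub>G\<^esub> g1) h = tens q G (conj_by G g g1) (conj_by G g h) \<otimes>\<^bsub>T\<^esub> tens q G g h"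
    if "g \<in> carrier G" "g1 \<in> carrier G" "h \<in> carrier G" for g g1 h
    using presented_relation[OF tensor_rels.mult_left[OF that]] that
    by (simp add: tens_def cls_append)
  show "tens q G g (h \<otimes>\<^bsub>G\<^esub> h1) = tens q G g h \<otimes>\<^bsub>T\<^esub> tens q G (conj_by G h g) (conj_by G h h1)"
    if "g \<in> carrier G" "h \<in> carrier G" "h1 \<in> carrier G" for g h h1
    using presented_relation[OF tensor_rels.mult_right[OF that]] that
    by (simp add: tens_def cls_append)
qed (rule tens_closed)

interpretation crossed_pairing G T "tens q G" by (rule crossed_pairing_tens)

text \<open>
  It is enough to commute with the generators. Tensors are covered by \<open>self_commute\<close>; the relation
  \<open>diag_conj\<close> says that \<open>{(g,g)}\<close> acts on \<open>y \<otimes> y\<close> by conjugating \<open>y\<close>, which changes nothing.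
\<close>

lemma tens_diag_central:
  assumes y: "y \<in> carrier G" and t: "t \<in> carrier T"
  shows "t \<otimes>\<^bsub>T\<^esub> tens q G y y = tens q G y y \<otimes>\<^bsub>T\<^esub> t"
proof -
  let ?y = "tens q G y y"
  let ?C = "{t \<in> carrier T. t \<otimes>\<^bsub>T\<^esub> ?y = ?y \<otimes>\<^bsub>T\<^esub> t}"
  have [simp]: "?y \<in> carrier T" using y by simp
  have "cls (letter x) \<in> ?C" if x: "x \<in> tensor_gens q G" for x
  proof (cases x)
    case (Tens g h)
    then have "g \<in> carrier G" "h \<in> carrier G" using x by (auto simp: tensor_gens_def split: if_splits)
    then show ?thesis using y Tens self_commute[of y g h]
      by (simp add: tens_def[symmetric])
  next
    case (Diag g)
    then have q: "1 \<le> q" and g: "g \<in> carrier G"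
      using x by (auto simp: tensor_gens_def split: if_splits)
    have "conj_by T (cls (wdiag g)) ?y
      = tens q G (conj_by G (g [^]\<^bsub>G\<^esub> q) y) (conj_by G (g [^]\<^bsub>G\<^esub> q) y)"
      using presented_relation[OF tensor_rels.diag_conj[OF q g y y], of "tensor_gens q G"] q g y
      by (simp add: conj_by_def[of T] cls_append cls_winv tens_def cls_closed T.m_assoc)
    then show ?thesis using q g y Diag
      by (simp add: self_conj cls_closed flip: T.conj_by_eq_iff_commute)
  qed
  then have "carrier T \<subseteq> ?C"
    using presented_group_generated T.subgroup_centralizer[OF \<open>?y \<in> carrier T\<close>]
    unfolding tensor_square_def by blast
  then show ?thesis using t by auto
qed

text \<open>
  All tensors in the relation \<open>diag_mult\<close> for \<open>1 \<cdot> 1\<close> are trivial, so \<open>{(1,1)}\<close> is idempotent.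
\<close>

lemma diag_one:
  assumes q: "1 \<le> q"
  shows "cls (wdiag \<one>\<^bsub>G\<^esub>) = \<one>\<^bsub>T\<^esub>"
proof -
  let ?d = "wdiag \<one>\<^bsub>G\<^esub>"
  let ?w = "concat (map (\<lambda>i. wtens (inv\<^bsub>G\<^esub> \<one>\<^bsub>G\<^esub>)
    (conj_by G (\<one>\<^bsub>G\<^esub> [^]\<^bsub>G\<^esub> (1 - int q + int i)) \<one>\<^bsub>G\<^esub> [^]\<^bsub>G\<^esub> i)) [1..<q])"
  have "cls (concat (map (\<lambda>i. wtens \<one>\<^bsub>G\<^esub> \<one>\<^bsub>G\<^esub>) l)) = \<one>\<^bsub>T\<^esub> \<and>
    concat (map (\<lambda>i. wtens \<one>\<^bsub>G\<^esub> \<one>\<^bsub>G\<^esub>) l) \<in> gwords (tensor_gens q G)" for l :: "nat list"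
    by (induction l) (simp_all add: cls_Nil cls_append tens_def[symmetric])
  then have w: "cls ?w = \<one>\<^bsub>T\<^esub> \<and> ?w \<in> gwords (tensor_gens q G)"
    by simp
  have d: "?d \<in> gwords (tensor_gens q G)" using q by simp
  have "cls (wdiag (\<one>\<^bsub>G\<^esub> \<otimes>\<^bsub>G\<^esub> \<one>\<^bsub>G\<^esub>)) = cls (?d @ ?w @ ?d)"
    by (rule presented_relation[OF tensor_rels.diag_mult[OF q G.one_closed G.one_closed]])
      (use w d in simp_all)
  also have "\<dots> = cls ?d \<otimes>\<^bsub>T\<^esub> cls ?d"
    using w d by (simp only: cls_append gwords_append simp_thms T.l_one cls_closed)
  finally have "cls ?d = cls ?d \<otimes>\<^bsub>T\<^esub> cls ?d" by (simp only: G.l_one G.one_closed)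
  then show ?thesis by (metis T.r_cancel_one' cls_closed d)
qed

text \<open>
  The relation \<open>diag_of_commutator\<close> for \<open>[g,g] = 1\<close>.
\<close>

lemma tens_diag_pow:
  assumes g: "g \<in> carrier G"
  shows "tens q G g g [^]\<^bsub>T\<^esub> int q = \<one>\<^bsub>T\<^esub>"
proof (cases "q = 0")
  case False
  then have q: "1 \<le> q" by simp
  have *: "cls (concat (replicate n (wtens g g))) = tens q G g g [^]\<^bsub>T\<^esub> int n \<and>
    concat (replicate n (wtens g g)) \<in> gwords (tensor_gens q G)" for n
    using g by (induction n) (simp_all add: cls_Nil cls_append T.int_pow_mult tens_def[symmetric])
  have "commutator G g g = \<one>\<^bsub>G\<^esub>" using g by (simp add: commutator_def G.m_assoc)
  then show ?thesis
    using presented_relation[OF tensor_rels.diag_of_commutator[OF q g g]] q g * diag_one[OF q]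
    by simp
qed simp

section \<open>The subgroup generated by the diagonal tensors\<close>

lemma nabla_central:
  assumes "x \<in> nabla q G" and "t \<in> carrier T"
  shows "t \<otimes>\<^bsub>T\<^esub> x = x \<otimes>\<^bsub>T\<^esub> t"
proof -
  let ?Z = "{x \<in> carrier T. \<forall>t\<in>carrier T. t \<otimes>\<^bsub>T\<^esub> x = x \<otimes>\<^bsub>T\<^esub> t}"
  have "?Z \<lhd> T"
    by (rule T.central_subgroup_normal[OF T.subgroup_center]) simp
  moreover have "{tens q G g g |g. g \<in> carrier G} \<subseteq> ?Z"
    using tens_diag_central by auto
  ultimately have "nabla q G \<subseteq> ?Z"
    unfolding nabla_def normal_closure_def by blast
  then show ?thesis using assms by blast
qed

lemma subgroup_nabla: "subgroup (nabla q G) T"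
  by (rule normal_imp_subgroup[OF nabla_normal])

lemma tens_diag_nabla: "g \<in> carrier G \<Longrightarrow> tens q G g g \<in> nabla q G"
  by (auto simp: nabla_def normal_closure_def)

lemma nabla_carrier: "x \<in> nabla q G \<Longrightarrow> x \<in> carrier T"
  by (rule subgroup.mem_carrier[OF subgroup_nabla])

text \<open>
  The diagonal tensors are central, so the subgroup that they generate is already normal.
\<close>

lemma nabla_induct [consumes 1, case_names diag mult inv]:
  assumes "x \<in> nabla q G"
    and diag: "\<And>g. g \<in> carrier G \<Longrightarrow> P (tens q G g g)"
    and mult: "\<And>x y. \<lbrakk>x \<in> nabla q G; y \<in> nabla q G; P x; P y\<rbrakk> \<Longrightarrow> P (x \<otimes>\<^bsub>T\<^esub> y)"
    and inv: "\<And>x. \<lbrakk>x \<in> nabla q G; P x\<rbrakk> \<Longrightarrow> P (inv\<^bsub>T\<^esub> x)"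
  shows "P x"
proof -
  let ?N = "{x \<in> nabla q G. P x}"
  have "tens q G \<one>\<^bsub>G\<^esub> \<one>\<^bsub>G\<^esub> \<in> ?N"
    using diag[OF G.one_closed] tens_diag_nabla[OF G.one_closed] by blast
  then have "subgroup ?N T"
    using mult inv subgroup.m_closed[OF subgroup_nabla] subgroup.m_inv_closed[OF subgroup_nabla]
    by (intro T.subgroupI) (auto dest: nabla_carrier)
  then have "?N \<lhd> T"
    by (rule T.central_subgroup_normal) (simp add: nabla_central)
  moreover have "{tens q G g g |g. g \<in> carrier G} \<subseteq> ?N"
    using diag tens_diag_nabla by auto
  ultimately have "nabla q G \<subseteq> ?N"
    unfolding nabla_def normal_closure_def by blast
  then show ?thesis using assms(1) by blast
qed

lemma nabla_int_pow:
  assumes "x \<in> nabla q G" and "\<And>g. g \<in> carrier G \<Longrightarrow> tens q G g g [^]\<^bsub>T\<^esub> (n::int) = \<one>\<^bsub>T\<^esub>"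
  shows "x [^]\<^bsub>T\<^esub> n = \<one>\<^bsub>T\<^esub>"
  using assms(1)
proof (induction rule: nabla_induct)
  case (mult x y)
  then show ?case
    using nabla_carrier nabla_central T.int_pow_mult_distrib[of y x n] by simp
next
  case (inv x)
  then show ?case using nabla_carrier T.int_pow_inv by simp
qed (rule assms(2))

lemma sym_pair_nabla: "g \<in> carrier G \<Longrightarrow> h \<in> carrier G \<Longrightarrow> sym_pair g h \<in> nabla q G"
  unfolding sym_pair_eq[of h g]
  by (intro subgroup.m_closed[OF subgroup_nabla] subgroup.m_inv_closed[OF subgroup_nabla]
      tens_diag_nabla) simp_all

section \<open>The retraction\<close>

text \<open>
  With \<open>2m = k + 1\<close>, the values \<open>\<langle>g,h\<rangle>\<close> to the power \<open>m\<close> on \<open>g \<otimes> h\<close> and \<open>1\<close> on \<open>{(g,g)}\<close> satisfy all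
  the relations in \<open>\<nabla>\<close> and fix the generators \<open>g \<otimes> g\<close>.
\<close>

lemma tensor_square_retract:
  assumes k: "odd k"
    and diag_k: "\<And>g. g \<in> carrier G \<Longrightarrow> tens q G g g [^]\<^bsub>T\<^esub> (k::int) = \<one>\<^bsub>T\<^esub>"
  obtains \<phi> where "\<phi> \<in> hom T (nabla_group q G)" and "\<And>x. x \<in> nabla q G \<Longrightarrow> \<phi> x = x"
proof -
  interpret N: group "nabla_group q G"
    unfolding nabla_group_def by (rule T.subgroup_imp_group[OF subgroup_nabla])
  have N_simps [simp]: "carrier (nabla_group q G) = nabla q G"
      "mult (nabla_group q G) = mult T" "one (nabla_group q G) = \<one>\<^bsub>T\<^esub>"
    by (simp_all add: nabla_group_def)
  have pow_k: "x [^]\<^bsub>T\<^esub> k = \<one>\<^bsub>T\<^esub>" if "x \<in> nabla q G" for x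
    using nabla_int_pow[OF that diag_k] .
  have pow_q: "x [^]\<^bsub>T\<^esub> (int q) = \<one>\<^bsub>T\<^esub>" if "x \<in> nabla q G" for x
    using nabla_int_pow[OF that, of "int q"] tens_diag_pow by simp
  \<comment> \<open>The exponent of \<open>\<nabla>\<close> divides both \<open>q\<close> and the odd \<open>k\<close>, so a factor two in a multiple of
    \<open>q\<close> may be dropped: \<open>i = ki - 2il\<close> for \<open>k = 2l + 1\<close>.\<close>
  have pow_dvd: "x [^]\<^bsub>T\<^esub> i = \<one>\<^bsub>T\<^esub>" if x: "x \<in> nabla q G" and i: "int q dvd 2 * i" for x i
  proof -
    have [simp]: "x \<in> carrier T" using x by (rule nabla_carrier)
    obtain j where j: "2 * i = int q * j" using i by blast
    obtain l where l: "k = 2 * l + 1" using k by (auto elim: oddE)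
    have "x [^]\<^bsub>T\<^esub> i = x [^]\<^bsub>T\<^esub> (k * i + int q * (- l * j))"
      by (rule arg_cong[where f = "\<lambda>i. x [^]\<^bsub>T\<^esub> i"]) (use j l in algebra)
    also have "\<dots> = \<one>\<^bsub>T\<^esub>"
      using pow_k[OF x] pow_q[OF x]
      by (simp only: T.int_pow_mult \<open>x \<in> carrier T\<close> flip: T.int_pow_pow) simp
    finally show ?thesis .
  qed
  define m where "m = (k + 1) div 2"
  have m: "2 * m = k + 1" using k unfolding m_def by presburger
  define f where "f x = (case x of Tens g h \<Rightarrow> sym_pair g h [^]\<^bsub>T\<^esub> m | Diag g \<Rightarrow> \<one>\<^bsub>T\<^esub>)" for x
  have pow_closed: "x [^]\<^bsub>T\<^esub> i \<in> nabla q G" if "x \<in> nabla q G" for x and i :: int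
    using T.int_pow_consistent[OF subgroup_nabla that] N.int_pow_closed[of x i] that
    by (simp add: nabla_group_def)
  have f_closed: "f \<in> tensor_gens q G \<rightarrow> carrier (nabla_group q G)"
    using pow_closed sym_pair_nabla subgroup.one_closed[OF subgroup_nabla]
    by (auto simp: f_def tensor_gens_def split: if_splits)
  let ?v = "word_value (nabla_group q G) f"
  have v_append: "?v (u @ w) = ?v u \<otimes>\<^bsub>T\<^esub> ?v w"
    if "u \<in> gwords (tensor_gens q G)" "w \<in> gwords (tensor_gens q G)" for u w
    using N.word_value_append[OF f_closed that] by simp
  have v_tens [simp]: "?v (wtens g h) = sym_pair g h [^]\<^bsub>T\<^esub> m" if "g \<in> carrier G" "h \<in> carrier G" for g h
    using that by (simp add: letter_def f_def)
  have inv_one: "inv\<^bsub>nabla_group q G\<^esub> \<one>\<^bsub>T\<^esub> = \<one>\<^bsub>T\<^esub>"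
    using N.inv_one by simp
  have v_diag [simp]: "?v (wdiag g) = \<one>\<^bsub>T\<^esub>" "?v (winv (wdiag g)) = \<one>\<^bsub>T\<^esub>" for g
    by (simp_all add: letter_def f_def winv_def inv_one)
  have relations: "?v u = ?v w" if "(u, w) \<in> tensor_rels q G" for u w
    using that
  proof cases
    case (mult_left g g1 h)
    then show ?thesis
      by (simp add: v_append sym_pair_conj_both sym_pair_mult_left
          T.int_pow_mult_distrib[OF sym_pair_commute_sym_pair])
  next
    case (mult_right g h h1)
    then show ?thesis
      by (simp add: v_append sym_pair_conj_both sym_pair_mult_right
          T.int_pow_mult_distrib[OF sym_pair_commute_sym_pair])
  next
    case (diag_conj g g1 h1)
    then show ?thesis by (simp add: v_append sym_pair_conj_both)
  next
    case (diag_mult g g1)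
    let ?w = "\<lambda>n. concat (map (\<lambda>i. wtens (inv\<^bsub>G\<^esub> g)
      (conj_by G (g [^]\<^bsub>G\<^esub> (1 - int q + int i)) g1 [^]\<^bsub>G\<^esub> i)) [1..<n])"
    \<comment> \<open>By bilinearity the conjugations disappear and the \<open>i\<close>-th factor becomes \<open>z\<close> to the power
      \<open>mi\<close>.\<close>
    define z where "z = sym_pair (inv\<^bsub>G\<^esub> g) g1"
    have z: "z \<in> nabla q G" "z \<in> carrier T"
      using diag_mult by (simp_all add: z_def sym_pair_nabla)
    have w: "?w n \<in> gwords (tensor_gens q G)" for n
      using diag_mult by (induction n) simp_all
    have "?v (?w n) = z [^]\<^bsub>T\<^esub> (m * (\<Sum>i\<in>{1..<n}. int i))" for n
    proof (induction n)
      case (Suc n)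
      have "sym_pair (inv\<^bsub>G\<^esub> g) (conj_by G (g [^]\<^bsub>G\<^esub> (1 - int q + int n)) g1 [^]\<^bsub>G\<^esub> n) = z [^]\<^bsub>T\<^esub> int n"
        using diag_mult by (simp add: sym_pair_pow_right sym_pair_conj_right z_def int_pow_int)
      then show ?case
        using Suc diag_mult w[of n] z
        by (cases "n = 0") (simp_all add: v_append T.int_pow_pow T.int_pow_mult distrib_left mult.commute)
    qed simp
    moreover have "int q dvd 2 * (m * (\<Sum>i\<in>{1..<q}. int i))"
    proof -
      have "2 * (\<Sum>i\<in>{1..<n}. int i) = int n * (int n - 1)" for n
        by (induction n) (auto simp: algebra_simps)
      then show ?thesis by (metis dvd_triv_left dvd_mult mult.left_commute)
    qed
    ultimately have "?v (?w q) = \<one>\<^bsub>T\<^esub>" using pow_dvd[OF z(1)] by simp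
    then show ?thesis using diag_mult w[of q] by (simp add: v_append)
  next
    case (diag_commutator g g1)
    have "sym_pair (g [^]\<^bsub>G\<^esub> q) (g1 [^]\<^bsub>G\<^esub> q) = \<one>\<^bsub>T\<^esub>"
      using diag_commutator pow_q[of "sym_pair (g [^]\<^bsub>G\<^esub> q) g1"] sym_pair_nabla
      by (simp add: sym_pair_pow_right int_pow_int)
    then show ?thesis using diag_commutator by (simp add: v_append)
  next
    case (diag_of_commutator g h)
    have "?v (concat (replicate n (wtens g h))) = sym_pair g h [^]\<^bsub>T\<^esub> (m * int n) \<and>
      concat (replicate n (wtens g h)) \<in> gwords (tensor_gens q G)" for n
      using diag_of_commutator
      by (induction n) (simp_all add: v_append distrib_left T.int_pow_mult)
    moreover have "sym_pair g h [^]\<^bsub>T\<^esub> (m * int q) = \<one>\<^bsub>T\<^esub>"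
      using diag_of_commutator pow_dvd sym_pair_nabla by simp
    ultimately show ?thesis using diag_of_commutator by simp
  qed
  obtain \<phi> where \<phi>: "\<phi> \<in> hom T (nabla_group q G)"
    and val: "\<And>w. w \<in> gwords (tensor_gens q G) \<Longrightarrow> \<phi> (cls w) = ?v w"
    using N.hom_from_presented_group[OF f_closed relations] unfolding tensor_square_def by blast
  interpret \<phi>: group_hom T "nabla_group q G" \<phi>
    using \<phi> by unfold_locales
  have "\<phi> x = x" if "x \<in> nabla q G" for x
    using that
  proof (induction rule: nabla_induct)
    case (diag g)
    have "\<phi> (tens q G g g) = sym_pair g g [^]\<^bsub>T\<^esub> m"
      using diag by (simp add: tens_def val)
    also have "sym_pair g g = tens q G g g [^]\<^bsub>T\<^esub> (2::int)"
      using diag by (simp add: sym_pair_self T.int_pow_mult[of _ 1 1, simplified])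
    also have "\<dots> [^]\<^bsub>T\<^esub> m = tens q G g g"
      using diag by (simp add: T.int_pow_pow m T.int_pow_mult diag_k)
    finally show ?case .
  next
    case (mult x y)
    then show ?case using nabla_carrier \<phi>.hom_mult by simp
  next
    case (inv x)
    then show ?case
      using nabla_carrier \<phi>.hom_inv[of x] T.m_inv_consistent[OF subgroup_nabla]
      by (simp add: nabla_group_def)
  qed
  with \<phi> show thesis by (rule that)
qed

end

theorem theorem5p2:
  fixes G :: "('a, 'b) monoid_scheme" and q :: nat and k :: int
  assumes "group G"
    and "odd k"
    and "\<And>g. g \<in> carrier G \<Longrightarrow>
      tens q G g g [^]\<^bsub>tensor_square q G\<^esub> k = \<one>\<^bsub>tensor_square q G\<^esub>"
  shows "tensor_square q G \<cong> nabla_group q G \<times>\<times> exterior_square q G"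
proof -
  obtain \<phi> where "\<phi> \<in> hom (tensor_square q G) (nabla_group q G)"
    and "\<And>x. x \<in> nabla q G \<Longrightarrow> \<phi> x = x"
    using tensor_square_retract[OF assms] by blast
  then show ?thesis
    using group.normal_retract_iso[OF group_tensor_square nabla_normal]
    unfolding nabla_group_def exterior_square_def by blast
qed

end
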